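(* Let $F$ be a finite field. Then the product ring $\prod_{\mathbb{N}} F$ is isomorphic, as a ring, to the direct limit of a directed system of rings each of which is a finite direct product of fields.
   Context: All rings are commutative with identity. $\prod_{\mathbb{N}}F$ is the product of countably infinitely many copies of $F$ with componentwise operations. Directed systems are indexed by directed posets. *)

theory Defs
  imports "HOL-Algebra.Algebra"
begin

section \<open>Products of rings\<close>

text \<open>The ring analogue of \<^const>\<open>product_group\<close>; the index set may be infinite.\<close>

definition product_ring :: "'i set \<Rightarrow> ('i \<Rightarrow> ('a, 'm) ring_scheme) \<Rightarrow> ('i \<Rightarrow> 'a) ring"
  where "product_ring I R =
    \<lparr>carrier = (\<Pi>\<^sub>E i\<in>I. carrier (R i)),
     monoid.mult = (\<lambda>x y. \<lambda>i\<in>I. x i \<otimes>\<^bsub>R i\<^esub> y i),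
     one = (\<lambda>i\<in>I. \<one>\<^bsub>R i\<^esub>),
     ring.zero = (\<lambda>i\<in>I. \<zero>\<^bsub>R i\<^esub>),
     add = (\<lambda>x y. \<lambda>i\<in>I. x i \<oplus>\<^bsub>R i\<^esub> y i)\<rparr>"

lemma product_ring_simps [simp]:
  "carrier (product_ring I R) = (\<Pi>\<^sub>E i\<in>I. carrier (R i))"
  "x \<otimes>\<^bsub>product_ring I R\<^esub> y = (\<lambda>i\<in>I. x i \<otimes>\<^bsub>R i\<^esub> y i)"
  "\<one>\<^bsub>product_ring I R\<^esub> = (\<lambda>i\<in>I. \<one>\<^bsub>R i\<^esub>)"
  "\<zero>\<^bsub>product_ring I R\<^esub> = (\<lambda>i\<in>I. \<zero>\<^bsub>R i\<^esub>)"
  "x \<oplus>\<^bsub>product_ring I R\<^esub> y = (\<lambda>i\<in>I. x i \<oplus>\<^bsub>R i\<^esub> y i)"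
  by (simp_all add: product_ring_def)

lemma product_ring_cring:
  assumes "\<And>i. i \<in> I \<Longrightarrow> cring (R i)"
  shows "cring (product_ring I R)"
proof (rule cringI)
  note R = cring.cring_simprules[OF assms]
  show "abelian_group (product_ring I R)"
  proof (rule abelian_groupI)
    fix x assume "x \<in> carrier (product_ring I R)"
    then show "\<exists>y\<in>carrier (product_ring I R). y \<oplus>\<^bsub>product_ring I R\<^esub> x = \<zero>\<^bsub>product_ring I R\<^esub>"
      by (intro bexI[of _ "\<lambda>i\<in>I. \<ominus>\<^bsub>R i\<^esub> x i"]) (auto simp: PiE_iff R(3,9))
  qed (auto simp: PiE_iff extensional_def fun_eq_iff R(1,2,7,8) intro: R(10))
  show "comm_monoid (product_ring I R)"
    by (rule comm_monoidI) (auto simp: PiE_iff extensional_def fun_eq_iff R(5,6,11,12) intro: R(14))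
  fix x y z
  assume "x \<in> carrier (product_ring I R)" "y \<in> carrier (product_ring I R)"
    "z \<in> carrier (product_ring I R)"
  then show "(x \<oplus>\<^bsub>product_ring I R\<^esub> y) \<otimes>\<^bsub>product_ring I R\<^esub> z =
      x \<otimes>\<^bsub>product_ring I R\<^esub> z \<oplus>\<^bsub>product_ring I R\<^esub> y \<otimes>\<^bsub>product_ring I R\<^esub> z"
    by (simp add: PiE_iff fun_eq_iff R(13))
qed

text \<open>A finite direct product of fields, up to isomorphism; the empty product is the zero ring.
  Letting the factors live on the element type of \<open>R\<close> itself is no restriction: each factor of a
  finite product embeds, as a set, into the product and hence into the carrier of \<open>R\<close>.\<close>

definition finite_product_of_fields :: "('a, 'm) ring_scheme \<Rightarrow> bool"
  where "finite_product_of_fields R \<longleftrightarrow>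
    (\<exists>Ks :: 'a ring list. (\<forall>K\<in>set Ks. field K) \<and> R \<simeq> RDirProd_list Ks)"


section \<open>Direct limits of rings\<close>

text \<open>A directed system of commutative rings over a nonempty directed poset, where
  \<open>(i, j) \<in> r\<close> means \<open>i \<le> j\<close>. Maps are only constrained on carriers.\<close>

locale directed_ring_system =
  fixes I :: "'i set" and r :: "'i rel"
    and R :: "'i \<Rightarrow> ('a, 'm) ring_scheme" and \<phi> :: "'i \<Rightarrow> 'i \<Rightarrow> 'a \<Rightarrow> 'a"
  assumes poset: "partial_order_on I r"
    and nonempty: "I \<noteq> {}"
    and directed: "\<lbrakk>i \<in> I; j \<in> I\<rbrakk> \<Longrightarrow> \<exists>k\<in>I. (i, k) \<in> r \<and> (j, k) \<in> r"
    and ring: "i \<in> I \<Longrightarrow> cring (R i)"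
    and hom: "(i, j) \<in> r \<Longrightarrow> \<phi> i j \<in> ring_hom (R i) (R j)"
    and map_id: "\<lbrakk>i \<in> I; x \<in> carrier (R i)\<rbrakk> \<Longrightarrow> \<phi> i i x = x"
    and map_comp: "\<lbrakk>(i, j) \<in> r; (j, k) \<in> r; x \<in> carrier (R i)\<rbrakk> \<Longrightarrow> \<phi> j k (\<phi> i j x) = \<phi> i k x"

text \<open>The direct limit is the disjoint union of the \<open>R i\<close> modulo eventual equality.\<close>

definition limit_rel ::
  "'i set \<Rightarrow> 'i rel \<Rightarrow> ('i \<Rightarrow> ('a, 'm) ring_scheme) \<Rightarrow> ('i \<Rightarrow> 'i \<Rightarrow> 'a \<Rightarrow> 'a) \<Rightarrow> ('i \<times> 'a) rel"
  where "limit_rel I r R \<phi> =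
    {((i, x), (j, y)). i \<in> I \<and> x \<in> carrier (R i) \<and> j \<in> I \<and> y \<in> carrier (R j) \<and>
       (\<exists>k\<in>I. (i, k) \<in> r \<and> (j, k) \<in> r \<and> \<phi> i k x = \<phi> j k y)}"

text \<open>An operation on classes is computed by moving representatives to a common upper bound. Each
  union below ranges over all choices and, in a directed system, is a union of equal classes.\<close>

definition limit_op ::
  "('i \<Rightarrow> 'a \<Rightarrow> 'a \<Rightarrow> 'a) \<Rightarrow> 'i set \<Rightarrow> 'i rel \<Rightarrow> ('i \<Rightarrow> ('a, 'm) ring_scheme) \<Rightarrow>
    ('i \<Rightarrow> 'i \<Rightarrow> 'a \<Rightarrow> 'a) \<Rightarrow> ('i \<times> 'a) set \<Rightarrow> ('i \<times> 'a) set \<Rightarrow> ('i \<times> 'a) set"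
  where "limit_op f I r R \<phi> A B =
    (\<Union>(i, x)\<in>A. \<Union>(j, y)\<in>B. \<Union>k\<in>{k \<in> I. (i, k) \<in> r \<and> (j, k) \<in> r}.
       limit_rel I r R \<phi> `` {(k, f k (\<phi> i k x) (\<phi> j k y))})"

definition direct_limit ::
  "'i set \<Rightarrow> 'i rel \<Rightarrow> ('i \<Rightarrow> ('a, 'm) ring_scheme) \<Rightarrow> ('i \<Rightarrow> 'i \<Rightarrow> 'a \<Rightarrow> 'a) \<Rightarrow> ('i \<times> 'a) set ring"
  where "direct_limit I r R \<phi> =
    \<lparr>carrier = (SIGMA i:I. carrier (R i)) // limit_rel I r R \<phi>,
     monoid.mult = limit_op (\<lambda>k x y. x \<otimes>\<^bsub>R k\<^esub> y) I r R \<phi>,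
     one = (\<Union>i\<in>I. limit_rel I r R \<phi> `` {(i, \<one>\<^bsub>R i\<^esub>)}),
     ring.zero = (\<Union>i\<in>I. limit_rel I r R \<phi> `` {(i, \<zero>\<^bsub>R i\<^esub>)}),
     add = limit_op (\<lambda>k x y. x \<oplus>\<^bsub>R k\<^esub> y) I r R \<phi>\<rparr>"

context directed_ring_system
begin

abbreviation "cls i x \<equiv> limit_rel I r R \<phi> `` {(i, x)}"
abbreviation "L \<equiv> direct_limit I r R \<phi>"

lemma le_in: "(i, j) \<in> r \<Longrightarrow> i \<in> I \<and> j \<in> I"
  using partial_order_onD(4)[OF poset] by auto

lemma le_refl: "i \<in> I \<Longrightarrow> (i, i) \<in> r"
  using partial_order_onD(1)[OF poset] by (auto simp: refl_on_def)

lemma le_trans: "(i, j) \<in> r \<Longrightarrow> (j, k) \<in> r \<Longrightarrow> (i, k) \<in> r"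
  using partial_order_onD(2)[OF poset] by (auto dest: transD)

lemma map_closed: "(i, j) \<in> r \<Longrightarrow> x \<in> carrier (R i) \<Longrightarrow> \<phi> i j x \<in> carrier (R j)"
  using ring_hom_closed[OF hom] .

lemma equiv_limit_rel: "equiv (SIGMA i:I. carrier (R i)) (limit_rel I r R \<phi>)"
proof (rule equivI)
  show "limit_rel I r R \<phi> \<subseteq> (SIGMA i:I. carrier (R i)) \<times> (SIGMA i:I. carrier (R i))"
    by (auto simp: limit_rel_def)
  show "refl_on (SIGMA i:I. carrier (R i)) (limit_rel I r R \<phi>)"
    by (rule refl_onI) (auto simp: limit_rel_def intro: le_refl)
  show "sym (limit_rel I r R \<phi>)"
    by (rule symI) (fastforce simp: limit_rel_def)
  show "trans (limit_rel I r R \<phi>)"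
  proof (rule transI, clarsimp simp: limit_rel_def)
    fix i x j y k z a b
    assume A: "i \<in> I" "x \<in> carrier (R i)" "y \<in> carrier (R j)" "j \<in> I" "k \<in> I" "z \<in> carrier (R k)"
      "a \<in> I" "(i, a) \<in> r" "(j, a) \<in> r" "\<phi> i a x = \<phi> j a y"
      "b \<in> I" "(j, b) \<in> r" "(k, b) \<in> r" "\<phi> j b y = \<phi> k b z"
    obtain c where c: "c \<in> I" "(a, c) \<in> r" "(b, c) \<in> r" using directed A by blast
    have "\<phi> i c x = \<phi> a c (\<phi> j a y)" using A c by (metis map_comp)
    also have "\<dots> = \<phi> b c (\<phi> k b z)" using A c by (metis map_comp)
    finally have "\<phi> i c x = \<phi> k c z" using A c by (metis map_comp)
    then show "\<exists>c\<in>I. (i, c) \<in> r \<and> (k, c) \<in> r \<and> \<phi> i c x = \<phi> k c z"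
      using A c by (meson le_trans)
  qed
qed

lemma cls_eq_iff:
  assumes "i \<in> I" "x \<in> carrier (R i)" "j \<in> I" "y \<in> carrier (R j)"
  shows "cls i x = cls j y \<longleftrightarrow> (\<exists>k\<in>I. (i, k) \<in> r \<and> (j, k) \<in> r \<and> \<phi> i k x = \<phi> j k y)"
  using assms eq_equiv_class_iff[OF equiv_limit_rel, of "(i, x)" "(j, y)"]
  by (auto simp: limit_rel_def)

lemma cls_map:
  assumes "(i, k) \<in> r" "x \<in> carrier (R i)"
  shows "cls k (\<phi> i k x) = cls i x"
  using assms le_in[OF assms(1)] map_closed[OF assms]
  by (subst cls_eq_iff) (auto intro!: bexI[of _ k] le_refl simp: map_id)

lemma limit_op_cls:
  assumes f: "\<And>k x y. \<lbrakk>k \<in> I; x \<in> carrier (R k); y \<in> carrier (R k)\<rbrakk> \<Longrightarrow> f k x y \<in> carrier (R k)"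
    and fh: "\<And>k l x y. \<lbrakk>(k, l) \<in> r; x \<in> carrier (R k); y \<in> carrier (R k)\<rbrakk>
      \<Longrightarrow> \<phi> k l (f k x y) = f l (\<phi> k l x) (\<phi> k l y)"
    and k: "k \<in> I" "x \<in> carrier (R k)" "y \<in> carrier (R k)"
  shows "limit_op f I r R \<phi> (cls k x) (cls k y) = cls k (f k x y)"
proof -
  have eq: "cls c (f c (\<phi> i c x') (\<phi> j c y')) = cls k (f k x y)"
    if ix: "(i, x') \<in> cls k x" and jy: "(j, y') \<in> cls k y"
      and c: "c \<in> I" "(i, c) \<in> r" "(j, c) \<in> r"
    for i x' j y' c
  proof -
    obtain a where a: "a \<in> I" "(k, a) \<in> r" "(i, a) \<in> r" "\<phi> k a x = \<phi> i a x'"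
      and x': "i \<in> I" "x' \<in> carrier (R i)" using ix by (auto simp: limit_rel_def)
    obtain b where b: "b \<in> I" "(k, b) \<in> r" "(j, b) \<in> r" "\<phi> k b y = \<phi> j b y'"
      and y': "j \<in> I" "y' \<in> carrier (R j)" using jy by (auto simp: limit_rel_def)
    obtain d where d: "d \<in> I" "(a, d) \<in> r" "(b, d) \<in> r" using directed a b by blast
    obtain e where e: "e \<in> I" "(d, e) \<in> r" "(c, e) \<in> r" using directed c d by blast
    have ae: "(a, e) \<in> r" and be: "(b, e) \<in> r" using d e le_trans by blast+
    have ke: "(k, e) \<in> r" using a ae le_trans by blast
    have "\<phi> i e x' = \<phi> a e (\<phi> k a x)" using a ae x' by (metis map_comp)
    then have X: "\<phi> i e x' = \<phi> k e x" using a ae k by (metis map_comp)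
    have "\<phi> j e y' = \<phi> b e (\<phi> k b y)" using b be y' by (metis map_comp)
    then have Y: "\<phi> j e y' = \<phi> k e y" using b be k by (metis map_comp)
    have m: "\<phi> i c x' \<in> carrier (R c)" "\<phi> j c y' \<in> carrier (R c)"
      using c x' y' map_closed by auto
    have "\<phi> c e (f c (\<phi> i c x') (\<phi> j c y')) = f e (\<phi> i e x') (\<phi> j e y')"
      using fh[OF e(3) m] map_comp c e x' y' by simp
    also have "\<dots> = \<phi> k e (f k x y)" using fh[OF ke k(2,3)] X Y by simp
    finally show ?thesis using cls_eq_iff[OF c(1) f[OF c(1) m] k(1) f[OF k]] e ke by blast
  qed
  have "(k, x) \<in> cls k x" "(k, y) \<in> cls k y" "(k, k) \<in> r"
    using k le_refl by (auto simp: limit_rel_def)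
  then show ?thesis
    unfolding limit_op_def using eq k(1) by fast
qed

lemma limit_mult_cls:
  assumes "k \<in> I" "x \<in> carrier (R k)" "y \<in> carrier (R k)"
  shows "cls k x \<otimes>\<^bsub>L\<^esub> cls k y = cls k (x \<otimes>\<^bsub>R k\<^esub> y)"
proof -
  have "limit_op (\<lambda>k x y. x \<otimes>\<^bsub>R k\<^esub> y) I r R \<phi> (cls k x) (cls k y) = cls k (x \<otimes>\<^bsub>R k\<^esub> y)"
    using assms by (intro limit_op_cls)
      (auto intro: ring_hom_mult[OF hom] monoid.m_closed[OF ring.is_monoid] cring.axioms(1)[OF ring])
  then show ?thesis by (simp add: direct_limit_def)
qed

lemma limit_add_cls:
  assumes "k \<in> I" "x \<in> carrier (R k)" "y \<in> carrier (R k)"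
  shows "cls k x \<oplus>\<^bsub>L\<^esub> cls k y = cls k (x \<oplus>\<^bsub>R k\<^esub> y)"
proof -
  have "limit_op (\<lambda>k x y. x \<oplus>\<^bsub>R k\<^esub> y) I r R \<phi> (cls k x) (cls k y) = cls k (x \<oplus>\<^bsub>R k\<^esub> y)"
    using assms by (intro limit_op_cls)
      (auto intro: ring_hom_add[OF hom] ring.ring_simprules(1) cring.axioms(1)[OF ring])
  then show ?thesis by (simp add: direct_limit_def)
qed

lemma limit_one: "k \<in> I \<Longrightarrow> \<one>\<^bsub>L\<^esub> = cls k \<one>\<^bsub>R k\<^esub>"
proof -
  assume k: "k \<in> I"
  have o: "\<one>\<^bsub>R i\<^esub> \<in> carrier (R i)" if "i \<in> I" for i
    using ring[OF that] by (simp add: cring.cring_simprules)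
  have "cls i \<one>\<^bsub>R i\<^esub> = cls k \<one>\<^bsub>R k\<^esub>" if i: "i \<in> I" for i
  proof -
    obtain c where c: "(i, c) \<in> r" "(k, c) \<in> r" using directed[OF i k] by blast
    then show ?thesis using cls_map[OF c(1) o[OF i]] cls_map[OF c(2) o[OF k]] hom[THEN ring_hom_one]
      by simp
  qed
  then have "(\<Union>i\<in>I. cls i \<one>\<^bsub>R i\<^esub>) = cls k \<one>\<^bsub>R k\<^esub>" using k by blast
  then show ?thesis by (simp add: direct_limit_def)
qed

lemma limit_zero: "k \<in> I \<Longrightarrow> \<zero>\<^bsub>L\<^esub> = cls k \<zero>\<^bsub>R k\<^esub>"
proof -
  assume k: "k \<in> I"
  have o: "\<zero>\<^bsub>R i\<^esub> \<in> carrier (R i)" if "i \<in> I" for i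
    using ring[OF that] by (simp add: cring.cring_simprules)
  have "cls i \<zero>\<^bsub>R i\<^esub> = cls k \<zero>\<^bsub>R k\<^esub>" if i: "i \<in> I" for i
  proof -
    obtain c where c: "(i, c) \<in> r" "(k, c) \<in> r" using directed[OF i k] by blast
    have "\<phi> i c \<zero>\<^bsub>R i\<^esub> = \<zero>\<^bsub>R c\<^esub>" "\<phi> k c \<zero>\<^bsub>R k\<^esub> = \<zero>\<^bsub>R c\<^esub>"
      using c le_in by (auto intro!: ring_hom_zero[OF hom] cring.axioms(1)[OF ring])
    then show ?thesis using cls_map[OF c(1) o[OF i]] cls_map[OF c(2) o[OF k]] by simp
  qed
  then have "(\<Union>i\<in>I. cls i \<zero>\<^bsub>R i\<^esub>) = cls k \<zero>\<^bsub>R k\<^esub>" using k by blast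
  then show ?thesis by (simp add: direct_limit_def)
qed

lemma limit_carrier: "carrier L = {cls i x |i x. i \<in> I \<and> x \<in> carrier (R i)}"
  by (simp add: direct_limit_def quotient_def) blast

lemma limit_common2:
  assumes "A \<in> carrier L" "B \<in> carrier L"
  obtains k x y where "k \<in> I" "x \<in> carrier (R k)" "y \<in> carrier (R k)" "A = cls k x" "B = cls k y"
proof -
  obtain i x j y where A: "A = cls i x" "i \<in> I" "x \<in> carrier (R i)"
    and B: "B = cls j y" "j \<in> I" "y \<in> carrier (R j)"
    using assms unfolding limit_carrier by blast
  obtain k where k: "k \<in> I" "(i, k) \<in> r" "(j, k) \<in> r" using directed A(2) B(2) by blast
  show ?thesis
    by (rule that[OF k(1) map_closed[OF k(2) A(3)] map_closed[OF k(3) B(3)]])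
      (simp_all only: A(1) B(1) cls_map[OF k(2) A(3)] cls_map[OF k(3) B(3)])
qed

lemma limit_common3:
  assumes "A \<in> carrier L" "B \<in> carrier L" "C \<in> carrier L"
  obtains k x y z where "k \<in> I" "x \<in> carrier (R k)" "y \<in> carrier (R k)" "z \<in> carrier (R k)"
    "A = cls k x" "B = cls k y" "C = cls k z"
proof -
  obtain i x y where A: "i \<in> I" "x \<in> carrier (R i)" "y \<in> carrier (R i)" "A = cls i x" "B = cls i y"
    by (rule limit_common2[OF assms(1,2)])
  obtain j z where B: "C = cls j z" "j \<in> I" "z \<in> carrier (R j)"
    using assms(3) unfolding limit_carrier by blast
  obtain k where k: "k \<in> I" "(i, k) \<in> r" "(j, k) \<in> r" using directed A(1) B(2) by blast
  show ?thesis
    by (rule that[OF k(1) map_closed[OF k(2) A(2)] map_closed[OF k(2) A(3)] map_closed[OF k(3) B(3)]])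
      (simp_all only: A(4,5) B(1) cls_map[OF k(2) A(2)] cls_map[OF k(2) A(3)] cls_map[OF k(3) B(3)])
qed

lemma limit_clsI: "i \<in> I \<Longrightarrow> x \<in> carrier (R i) \<Longrightarrow> cls i x \<in> carrier L"
  unfolding limit_carrier by blast

lemma direct_limit_cring: "cring L"
proof (rule cringI)
  note R = cring.cring_simprules[OF ring]
  note simps = limit_mult_cls limit_add_cls limit_clsI R(1,2,3,5,6)
  obtain i0 where i0: "i0 \<in> I" using nonempty by blast
  show "abelian_group L"
  proof (rule abelian_groupI)
    show "\<zero>\<^bsub>L\<^esub> \<in> carrier L" using i0 by (simp only: limit_zero[OF i0] simps)
    fix A B C assume A: "A \<in> carrier L"
    obtain k x where A': "k \<in> I" "x \<in> carrier (R k)" "A = cls k x"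
      using A unfolding limit_carrier by blast
    show "\<zero>\<^bsub>L\<^esub> \<oplus>\<^bsub>L\<^esub> A = A"
      using A' by (simp only: limit_zero[OF A'(1)] simps R(8))
    show "\<exists>B\<in>carrier L. B \<oplus>\<^bsub>L\<^esub> A = \<zero>\<^bsub>L\<^esub>"
      using A' by (intro bexI[of _ "cls k (\<ominus>\<^bsub>R k\<^esub> x)"])
        (simp_all only: limit_zero[OF A'(1)] simps R(9))
    assume B: "B \<in> carrier L"
    obtain k x y where k: "k \<in> I" "x \<in> carrier (R k)" "y \<in> carrier (R k)"
      "A = cls k x" "B = cls k y" by (rule limit_common2[OF A B])
    show "A \<oplus>\<^bsub>L\<^esub> B \<in> carrier L" using k by (simp only: simps)
    show "A \<oplus>\<^bsub>L\<^esub> B = B \<oplus>\<^bsub>L\<^esub> A" using k R(10)[OF k(1-3)] by (simp only: simps)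
    assume C: "C \<in> carrier L"
    obtain k x y z where "k \<in> I" "x \<in> carrier (R k)" "y \<in> carrier (R k)" "z \<in> carrier (R k)"
      "A = cls k x" "B = cls k y" "C = cls k z" by (rule limit_common3[OF A B C])
    then show "A \<oplus>\<^bsub>L\<^esub> B \<oplus>\<^bsub>L\<^esub> C = A \<oplus>\<^bsub>L\<^esub> (B \<oplus>\<^bsub>L\<^esub> C)" by (simp only: simps R(7))
  qed
  show "comm_monoid L"
  proof (rule comm_monoidI)
    show "\<one>\<^bsub>L\<^esub> \<in> carrier L" using i0 by (simp only: limit_one[OF i0] simps)
    fix A B C assume A: "A \<in> carrier L"
    obtain k x where A': "k \<in> I" "x \<in> carrier (R k)" "A = cls k x"
      using A unfolding limit_carrier by blast
    show "\<one>\<^bsub>L\<^esub> \<otimes>\<^bsub>L\<^esub> A = A"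
      using A' by (simp only: limit_one[OF A'(1)] simps R(12))
    assume B: "B \<in> carrier L"
    obtain k x y where k: "k \<in> I" "x \<in> carrier (R k)" "y \<in> carrier (R k)"
      "A = cls k x" "B = cls k y" by (rule limit_common2[OF A B])
    show "A \<otimes>\<^bsub>L\<^esub> B \<in> carrier L" using k by (simp only: simps)
    show "A \<otimes>\<^bsub>L\<^esub> B = B \<otimes>\<^bsub>L\<^esub> A" using k R(14)[OF k(1-3)] by (simp only: simps)
    assume C: "C \<in> carrier L"
    obtain k x y z where "k \<in> I" "x \<in> carrier (R k)" "y \<in> carrier (R k)" "z \<in> carrier (R k)"
      "A = cls k x" "B = cls k y" "C = cls k z" by (rule limit_common3[OF A B C])
    then show "A \<otimes>\<^bsub>L\<^esub> B \<otimes>\<^bsub>L\<^esub> C = A \<otimes>\<^bsub>L\<^esub> (B \<otimes>\<^bsub>L\<^esub> C)" by (simp only: simps R(11))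
  qed
  fix A B C assume *: "A \<in> carrier L" "B \<in> carrier L" "C \<in> carrier L"
  obtain k x y z where "k \<in> I" "x \<in> carrier (R k)" "y \<in> carrier (R k)" "z \<in> carrier (R k)"
    "A = cls k x" "B = cls k y" "C = cls k z" by (rule limit_common3[OF *])
  then show "(A \<oplus>\<^bsub>L\<^esub> B) \<otimes>\<^bsub>L\<^esub> C = A \<otimes>\<^bsub>L\<^esub> C \<oplus>\<^bsub>L\<^esub> B \<otimes>\<^bsub>L\<^esub> C" by (simp only: simps R(13))
qed

end

end

theory Submission
  imports Defs "HOL-Library.Disjoint_Sets"
begin

text \<open>
  A sequence with values in a finite set takes each of its values on one of finitely many sets
  that partition the index set. So \<open>\<Prod>\<^sub>\<nat> F\<close> is the union of its subrings of
  functions that are constant on every block of \<open>P\<close>, where \<open>P\<close> runs through the finite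
  partitions of \<open>\<nat>\<close>. Such a subring is a product of copies of \<open>F\<close>, one for each
  block (\<open>finite_product_of_fields_blockwise_constant\<close>), and finiteness of \<open>F\<close> enters only
  in that these subrings exhaust the product (\<open>Union_blockwise_constant\<close>).

  Refining a partition enlarges the subring, and two finite partitions have a finite common
  refinement. The subrings therefore form a directed system with the inclusions as maps, and the
  direct limit of such a system is the union of the subrings
  (\<open>direct_limit_directed_union\<close>).
\<close>

section \<open>Directed unions of subrings are direct limits\<close>

lemma directed_ring_system_subrings:
  assumes "cring S" "partial_order_on I r" "I \<noteq> {}"
    and "\<And>i j. \<lbrakk>i \<in> I; j \<in> I\<rbrakk> \<Longrightarrow> \<exists>k\<in>I. (i, k) \<in> r \<and> (j, k) \<in> r"
    and sub: "\<And>i. i \<in> I \<Longrightarrow> subring (H i) S"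
    and mono: "\<And>i j. (i, j) \<in> r \<Longrightarrow> H i \<subseteq> H j"
  shows "directed_ring_system I r (\<lambda>i. S\<lparr>carrier := H i\<rparr>) (\<lambda>_ _ x. x)"
proof (rule directed_ring_system.intro)
  interpret S: cring S by fact
  show "cring (S\<lparr>carrier := H i\<rparr>)" if "i \<in> I" for i
    using S.subcring_iff[OF subringE(1)[OF sub[OF that]]] S.subcringI'[OF sub[OF that]] by blast
  show "(\<lambda>x. x) \<in> ring_hom (S\<lparr>carrier := H i\<rparr>) (S\<lparr>carrier := H j\<rparr>)" if "(i, j) \<in> r" for i j
    using mono[OF that] by (auto simp: ring_hom_def)
qed (fact assms | rule refl)+

text \<open>As all maps are inclusions, two elements are identified in the limit exactly if they are the
  same element of \<open>S\<close>. So the class of \<open>x\<close> consists of one copy of \<open>x\<close> for every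
  subring that contains it, which gives the isomorphism in closed form.\<close>

lemma direct_limit_directed_union:
  assumes sys: "directed_ring_system I r (\<lambda>i. S\<lparr>carrier := H i\<rparr>) (\<lambda>_ _ x. x)"
    and Un: "carrier S = (\<Union>i\<in>I. H i)"
  shows "S \<simeq> direct_limit I r (\<lambda>i. S\<lparr>carrier := H i\<rparr>) (\<lambda>_ _ x. x)"
proof -
  interpret directed_ring_system I r "\<lambda>i. S\<lparr>carrier := H i\<rparr>" "\<lambda>_ _ x. x" by (rule sys)
  define h where "h x = {i \<in> I. x \<in> H i} \<times> {x}" for x
  have cls: "cls i x = h x" if "i \<in> I" "x \<in> H i" for i x
  proof -
    have "\<exists>k\<in>I. (i, k) \<in> r \<and> (j, k) \<in> r" if "j \<in> I" for j
      by (rule directed[OF \<open>i \<in> I\<close> that])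
    then show ?thesis using that unfolding limit_rel_def h_def by fastforce
  qed
  have common: "\<exists>k\<in>I. x \<in> H k \<and> y \<in> H k" if xy: "x \<in> carrier S" "y \<in> carrier S" for x y
  proof -
    obtain i j where i: "i \<in> I" "x \<in> H i" and j: "j \<in> I" "y \<in> H j"
      using xy Un by blast
    obtain k where "k \<in> I" "(i, k) \<in> r" "(j, k) \<in> r" using directed i j by blast
    then show ?thesis using map_closed[of i k x] map_closed[of j k y] i j by auto
  qed
  have carrier: "carrier L = h ` carrier S"
    unfolding limit_carrier Un using cls by (force simp: image_iff)
  have "h \<in> ring_iso S L"
  proof (rule ring_iso_memI)
    fix x y assume xy: "x \<in> carrier S" "y \<in> carrier S"
    obtain k where k: "k \<in> I" "x \<in> H k" "y \<in> H k" using common[OF xy] by blast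
    interpret Rk: cring "S\<lparr>carrier := H k\<rparr>" by (rule ring[OF k(1)])
    show "h (x \<otimes>\<^bsub>S\<^esub> y) = h x \<otimes>\<^bsub>L\<^esub> h y"
      using limit_mult_cls[of k x y] k Rk.m_closed[of x y] by (simp add: cls)
    show "h (x \<oplus>\<^bsub>S\<^esub> y) = h x \<oplus>\<^bsub>L\<^esub> h y"
      using limit_add_cls[of k x y] k Rk.a_closed[of x y] by (simp add: cls)
  next
    obtain k where k: "k \<in> I" using nonempty by blast
    interpret Rk: cring "S\<lparr>carrier := H k\<rparr>" by (rule ring[OF k])
    show "h \<one>\<^bsub>S\<^esub> = \<one>\<^bsub>L\<^esub>"
      using limit_one[OF k] k Rk.one_closed by (simp add: cls)
  next
    have "inj_on h (carrier S)" using Un by (fastforce simp: inj_on_def h_def)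
    then show "bij_betw h (carrier S) (carrier L)" by (simp add: carrier bij_betw_def)
  qed (simp add: carrier)
  then show ?thesis by (auto simp: is_ring_iso_def)
qed

section \<open>Homomorphisms into finite products\<close>

lemma ring_hom_RDirProd_list:
  assumes "\<And>b. b \<in> set bs \<Longrightarrow> h b \<in> ring_hom R (S b)"
  shows "(\<lambda>x. map (\<lambda>b. h b x) bs) \<in> ring_hom R (RDirProd_list (map S bs))"
  using assms
proof (induction bs)
  case Nil
  then show ?case by (simp add: ring_hom_def monoid.defs)
next
  case (Cons b bs)
  have "(\<lambda>(x, y). (h b x, map (\<lambda>b. h b y) bs)) \<in>
      ring_hom (RDirProd R R) (RDirProd (S b) (RDirProd_list (map S bs)))"
    using Cons by (intro RDirProd_hom3) auto
  from ring_hom_trans[OF ring_hom_trans[OF RDirProd_hom1 this] RDirProd_list_hom1]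
  show ?case by (simp add: comp_def)
qed

section \<open>Blockwise constant functions\<close>

definition blockwise_constant :: "('a, 'm) ring_scheme \<Rightarrow> 'i set set \<Rightarrow> ('i \<Rightarrow> 'a) set"
  where "blockwise_constant F P =
    {f. range f \<subseteq> carrier F \<and> (\<forall>B\<in>P. \<exists>c. \<forall>n\<in>B. f n = c)}"

lemma blockwise_constantD:
  assumes "f \<in> blockwise_constant F P" "B \<in> P" "m \<in> B" "n \<in> B"
  shows "f m = f n"
proof -
  have "\<forall>B\<in>P. \<exists>c. \<forall>n\<in>B. f n = c" using assms(1) by (simp add: blockwise_constant_def)
  from bspec[OF this assms(2)] obtain c where "\<forall>n\<in>B. f n = c" ..
  then show ?thesis using assms(3,4) by simp
qed

lemma blockwise_constantI:
  assumes "\<And>n. f n \<in> carrier F" "\<And>B m n. \<lbrakk>B \<in> P; m \<in> B; n \<in> B\<rbrakk> \<Longrightarrow> f m = f n"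
  shows "f \<in> blockwise_constant F P"
proof -
  have "\<exists>c. \<forall>n\<in>B. f n = c" if B: "B \<in> P" for B
  proof (cases "B = {}")
    case False
    then obtain m where "m \<in> B" by blast
    with B have "\<forall>n\<in>B. f n = f m" by (intro ballI assms(2))
    then show ?thesis ..
  qed simp
  moreover have "range f \<subseteq> carrier F" using assms(1) by blast
  ultimately show ?thesis by (simp add: blockwise_constant_def)
qed

lemma blockwise_constant_closed: "f \<in> blockwise_constant F P \<Longrightarrow> f n \<in> carrier F"
  by (auto simp: blockwise_constant_def)

lemma subring_blockwise_constant:
  assumes "cring F"
  shows "subring (blockwise_constant F P) (product_ring UNIV (\<lambda>_. F))"
proof -
  interpret F: cring F by fact
  let ?S = "product_ring UNIV (\<lambda>_. F)"
  interpret S: cring ?S by (rule product_ring_cring) (rule F.is_cring)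
  have minus: "\<ominus>\<^bsub>?S\<^esub> f = (\<lambda>n. \<ominus>\<^bsub>F\<^esub> f n)" if "range f \<subseteq> carrier F" for f
    using that by (intro S.minus_equality) (auto simp: F.l_neg fun_eq_iff image_subset_iff)
  show ?thesis
  proof (rule S.subringI)
    fix f assume f: "f \<in> blockwise_constant F P"
    have eq: "\<ominus>\<^bsub>?S\<^esub> f = (\<lambda>n. \<ominus>\<^bsub>F\<^esub> f n)"
      using blockwise_constant_closed[OF f] by (intro minus) blast
    show "\<ominus>\<^bsub>?S\<^esub> f \<in> blockwise_constant F P"
      unfolding eq
    proof (rule blockwise_constantI)
      show "\<ominus>\<^bsub>F\<^esub> f m = \<ominus>\<^bsub>F\<^esub> f n" if "B \<in> P" "m \<in> B" "n \<in> B" for B m n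
        by (simp only: blockwise_constantD[OF f that])
    qed (simp add: blockwise_constant_closed[OF f])
  next
    fix f g assume f: "f \<in> blockwise_constant F P" and g: "g \<in> blockwise_constant F P"
    note closed = blockwise_constant_closed[OF f] blockwise_constant_closed[OF g]
    note eq = blockwise_constantD[OF f] blockwise_constantD[OF g]
    show "f \<otimes>\<^bsub>?S\<^esub> g \<in> blockwise_constant F P"
    proof (rule blockwise_constantI)
      show "(f \<otimes>\<^bsub>?S\<^esub> g) m = (f \<otimes>\<^bsub>?S\<^esub> g) n" if "B \<in> P" "m \<in> B" "n \<in> B" for B m n
        using eq[OF that] by simp
    qed (simp add: closed)
    show "f \<oplus>\<^bsub>?S\<^esub> g \<in> blockwise_constant F P"
    proof (rule blockwise_constantI)
      show "(f \<oplus>\<^bsub>?S\<^esub> g) m = (f \<oplus>\<^bsub>?S\<^esub> g) n" if "B \<in> P" "m \<in> B" "n \<in> B" for B m n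
        using eq[OF that] by simp
    qed (simp add: closed)
  qed (auto simp: blockwise_constant_def)
qed

text \<open>Evaluation at one point of each block is an isomorphism onto a product of copies of \<open>F\<close>, one
  per block. The factors have to live on the type \<open>'i \<Rightarrow> 'a\<close> of the elements of the subring, so
  each copy is realised by the constant functions.\<close>

lemma finite_product_of_fields_blockwise_constant:
  fixes F :: "('a, 'm) ring_scheme" and P :: "'i set set"
  assumes "field F" "partition_on UNIV P" "finite P"
  shows "finite_product_of_fields
    ((product_ring UNIV (\<lambda>_. F))\<lparr>carrier := blockwise_constant F P\<rparr>)"
proof -
  interpret F: field F by fact
  define const :: "'a \<Rightarrow> 'i \<Rightarrow> 'a" where "const a = (\<lambda>_. a)" for a
  define K where "K = image_ring const F"
  have inj: "inj_on const (carrier F)" by (auto simp: const_def inj_on_def fun_eq_iff)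
  have K: "field K" "const \<in> ring_hom F K" "carrier K = const ` carrier F"
    using F.inj_imp_image_ring_is_field[OF inj] inj_imp_image_ring_iso[OF inj]
    by (auto simp: K_def ring_iso_def image_ring_carrier)
  obtain Bs where Bs: "set Bs = P" "distinct Bs" using finite_distinct_list[OF assms(3)] by blast
  define pt :: "'i set \<Rightarrow> 'i" where "pt B = (SOME n. n \<in> B)" for B
  have pt: "pt B \<in> B" if "B \<in> P" for B
  proof -
    have "B \<noteq> {}" using that partition_onD3[OF assms(2)] by blast
    then show ?thesis unfolding pt_def by (simp add: some_in_eq)
  qed
  let ?R = "(product_ring UNIV (\<lambda>_. F))\<lparr>carrier := blockwise_constant F P\<rparr>"
  let ?h = "\<lambda>f. map (\<lambda>B. const (f (pt B))) Bs"
  have "(\<lambda>f. f (pt B)) \<in> ring_hom ?R F" for B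
    by (rule ring_hom_memI) (simp_all add: blockwise_constant_closed)
  from ring_hom_trans[OF this K(2)]
  have "(\<lambda>f. const (f (pt B))) \<in> ring_hom ?R K" for B by (simp add: comp_def)
  then have hom: "?h \<in> ring_hom ?R (RDirProd_list (map (\<lambda>_. K) Bs))"
    by (intro ring_hom_RDirProd_list)
  have "bij_betw ?h (carrier ?R) (carrier (RDirProd_list (map (\<lambda>_. K) Bs)))"
    unfolding bij_betw_def
  proof
    show "inj_on ?h (carrier ?R)"
    proof (rule inj_onI, rule ext)
      fix f g n assume fg: "f \<in> carrier ?R" "g \<in> carrier ?R" "?h f = ?h g"
      obtain B where B: "B \<in> P" "n \<in> B" using partition_onD1[OF assms(2)] by blast
      have "f n = f (pt B)" "g n = g (pt B)"
        using fg(1,2) blockwise_constantD[of _ F P, OF _ B(1) B(2) pt[OF B(1)]] by simp_all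
      moreover have "f (pt B) = g (pt B)"
        using fg(3) B(1) Bs(1) by (simp add: const_def fun_eq_iff)
      ultimately show "f n = g n" by simp
    qed
    show "?h ` carrier ?R = carrier (RDirProd_list (map (\<lambda>_. K) Bs))"
    proof (rule antisym[OF _ subsetI])
      show "?h ` carrier ?R \<subseteq> carrier (RDirProd_list (map (\<lambda>_. K) Bs))"
        using ring_hom_closed[OF hom] by blast
    next
      fix gs assume gs: "gs \<in> carrier (RDirProd_list (map (\<lambda>_. K) Bs))"
      have len: "length gs = length Bs" using RDirProd_list_carrier_mem(1)[OF gs] by simp
      have "\<forall>i<length Bs. \<exists>a\<in>carrier F. gs ! i = const a"
        using RDirProd_list_carrier_mem(2)[OF gs] K(3) by fastforce
      then obtain a where a: "\<And>i. i < length Bs \<Longrightarrow> a i \<in> carrier F \<and> gs ! i = const (a i)"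
        by metis
      have "\<forall>n. \<exists>i<length Bs. n \<in> Bs ! i"
        using partition_onD1[OF assms(2)] Bs(1) by (metis UNIV_I UnionE in_set_conv_nth)
      then obtain idx where idx: "\<And>n. idx n < length Bs \<and> n \<in> Bs ! idx n" by metis
      have idx_eq: "idx n = i" if "i < length Bs" "n \<in> Bs ! i" for i n
      proof -
        have "Bs ! idx n = Bs ! i"
          using that idx[of n] disjointD[OF partition_onD2[OF assms(2)]] Bs(1)
          by (metis disjoint_iff nth_mem)
        then show ?thesis using that idx Bs(2) nth_eq_iff_index_eq by blast
      qed
      \<comment> \<open>The preimage of \<open>gs\<close> takes on each block the constant value of the entry of \<open>gs\<close> at the
        position of that block in \<open>Bs\<close>; \<open>idx\<close> finds this position.\<close>
      let ?f = "\<lambda>n. a (idx n)"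
      have "?f m = ?f n" if "B \<in> P" "m \<in> B" "n \<in> B" for B m n
      proof -
        obtain i where "i < length Bs" "Bs ! i = B"
          using \<open>B \<in> P\<close> Bs(1) by (metis in_set_conv_nth)
        then show ?thesis using that idx_eq[of i m] idx_eq[of i n] by simp
      qed
      then have "?f \<in> blockwise_constant F P"
        using a idx by (intro blockwise_constantI) blast+
      then have "?f \<in> carrier ?R" by simp
      moreover have "?h ?f = gs"
      proof (rule nth_equalityI)
        show "?h ?f ! i = gs ! i" if "i < length (?h ?f)" for i
        proof -
          from that have i: "i < length Bs" by simp
          then have "pt (Bs ! i) \<in> Bs ! i" using pt nth_mem Bs(1) by blast
          then show ?thesis using i a[OF i] idx_eq[OF i] by simp
        qed
      qed (simp add: len)
      ultimately show "gs \<in> ?h ` carrier ?R" by (intro image_eqI[of gs ?h ?f]) simp_all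
    qed
  qed
  with hom have "?R \<simeq> RDirProd_list (map (\<lambda>_. K) Bs)"
    unfolding is_ring_iso_def ring_iso_def by blast
  then show ?thesis
    unfolding finite_product_of_fields_def using K(1) by (intro exI[of _ "map (\<lambda>_. K) Bs"]) auto
qed

lemma blockwise_constant_mono:
  assumes "refines UNIV Q P"
  shows "blockwise_constant F P \<subseteq> blockwise_constant F Q"
proof
  fix f assume f: "f \<in> blockwise_constant F P"
  show "f \<in> blockwise_constant F Q"
  proof (rule blockwise_constantI)
    fix B m n assume B: "B \<in> Q" and mn: "m \<in> B" "n \<in> B"
    obtain C where "C \<in> P" "B \<subseteq> C" using assms B unfolding refines_def by blast
    with mn show "f m = f n" by (intro blockwise_constantD[OF f, of C]) auto
  qed (rule blockwise_constant_closed[OF f])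
qed

text \<open>The nonempty fibres of a function into a finite set form a finite partition, and the function
  is constant on each of them.\<close>

lemma Union_blockwise_constant:
  fixes F :: "('a, 'm) ring_scheme"
  assumes "finite (carrier F)"
  shows "carrier (product_ring (UNIV :: 'i set) (\<lambda>_. F)) =
    (\<Union>P\<in>{P. partition_on UNIV P \<and> finite P}. blockwise_constant F P)"
proof (intro antisym subsetI)
  fix f :: "'i \<Rightarrow> 'a" assume "f \<in> carrier (product_ring UNIV (\<lambda>_. F))"
  then have f: "range f \<subseteq> carrier F" by auto
  let ?P = "(\<lambda>a. f -` {a}) ` range f"
  have "partition_on UNIV ?P"
    by (rule partition_onI) (auto simp: disjnt_iff)
  moreover have "finite ?P" using finite_subset[OF f assms] by blast
  moreover have "f \<in> blockwise_constant F ?P"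
    using f by (intro blockwise_constantI) auto
  ultimately show "f \<in> (\<Union>P\<in>{P. partition_on UNIV P \<and> finite P}. blockwise_constant F P)"
    by blast
qed (auto simp: blockwise_constant_def)

section \<open>The directed poset of finite partitions\<close>

text \<open>The finer partition is the larger one, because it allows more blockwise constant functions.\<close>

lemma partial_order_on_refinement:
  assumes "\<And>P. P \<in> I \<Longrightarrow> partition_on A P"
  shows "partial_order_on I {(P, Q). P \<in> I \<and> Q \<in> I \<and> refines A Q P}"
  unfolding partial_order_on_def preorder_on_def
  using assms
  by (auto simp: refl_on_def intro: refines_refl intro!: transI antisymI
      elim: refines_trans dest: refines_asym)

lemma finite_partitions_directed:
  assumes "partition_on A P" "finite P" "partition_on A Q" "finite Q"
  obtains T where "partition_on A T" "finite T" "refines A T P" "refines A T Q"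
proof
  let ?T = "common_refinement {P, Q}"
  show "partition_on A ?T" using assms by (intro partition_on_common_refinement) auto
  show "finite ?T" using assms by (intro finite_common_refinement) auto
  show "refines A ?T P" "refines A ?T Q" using assms by (auto intro: refines_common_refinement)
qed

theorem proposition5p3:
  fixes F :: "('a, 'm) ring_scheme"
  assumes "field F" and "finite (carrier F)"
  shows "\<exists>(I :: nat set set set) (r :: nat set set rel)
            (R :: nat set set \<Rightarrow> (nat \<Rightarrow> 'a) ring)
            (\<phi> :: nat set set \<Rightarrow> nat set set \<Rightarrow> (nat \<Rightarrow> 'a) \<Rightarrow> (nat \<Rightarrow> 'a)).
           directed_ring_system I r R \<phi> \<and>
           (\<forall>i\<in>I. finite_product_of_fields (R i)) \<and>
           product_ring (UNIV :: nat set) (\<lambda>_. F) \<simeq> direct_limit I r R \<phi>"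
proof -
  interpret F: field F by fact
  let ?S = "product_ring (UNIV :: nat set) (\<lambda>_. F)"
  let ?H = "blockwise_constant F :: nat set set \<Rightarrow> (nat \<Rightarrow> 'a) set"
  let ?I = "{P :: nat set set. partition_on UNIV P \<and> finite P}"
  let ?r = "{(P, Q). P \<in> ?I \<and> Q \<in> ?I \<and> refines UNIV Q P}"
  let ?R = "\<lambda>P. ?S\<lparr>carrier := ?H P\<rparr>"
  have sys: "directed_ring_system ?I ?r ?R (\<lambda>_ _ x. x)"
  proof (rule directed_ring_system_subrings)
    show "cring ?S" by (rule product_ring_cring) (rule F.is_cring)
    show "partial_order_on ?I ?r" by (rule partial_order_on_refinement) simp
    have "{UNIV} \<in> ?I" by (auto simp: partition_on_def)
    then show "?I \<noteq> {}" by blast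
    show "\<exists>T\<in>?I. (P, T) \<in> ?r \<and> (Q, T) \<in> ?r" if PQ: "P \<in> ?I" "Q \<in> ?I" for P Q
    proof -
      obtain T where "partition_on UNIV T" "finite T" "refines UNIV T P" "refines UNIV T Q"
        by (rule finite_partitions_directed[of UNIV P Q]) (use PQ in simp_all)
      then show ?thesis using PQ by (intro bexI[of _ T]) simp_all
    qed
    show "subring (?H P) ?S" for P by (rule subring_blockwise_constant) (rule F.is_cring)
    show "?H P \<subseteq> ?H Q" if "(P, Q) \<in> ?r" for P Q
      using that by (intro blockwise_constant_mono) simp
  qed
  have "?S \<simeq> direct_limit ?I ?r ?R (\<lambda>_ _ x. x)"
    by (rule direct_limit_directed_union[OF sys Union_blockwise_constant[OF assms(2)]])
  moreover have "\<forall>P\<in>?I. finite_product_of_fields (?R P)"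
    by (intro ballI finite_product_of_fields_blockwise_constant[OF assms(1)]) simp_all
  ultimately show ?thesis
    using sys by (intro exI[of _ ?I] exI[of _ ?r] exI[of _ ?R] exI[of _ "\<lambda>_ _ x. x"] conjI)
qed

end
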